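(* Let $n>1$ be an integer. Then there exists a polynomial $f\in\mathbb{R}[x,y]$ which is a sum of $2n$th powers of rational functions (elements of $\mathbb{R}(x,y)$) and such that $$\mathrm{codim}\big(\mathrm{Bad}_{2n}(f)\big)=2 .$$
   Context: For a nonnegative polynomial $f\in\mathbb{R}[x,y]$ and a positive integer $n$ put $$\mathrm{Denom}_{2n}(f)=\Big\{G\in\mathbb{R}[x,y] : G^{2n}f=\sum_{i=1}^N H_i^{2n}\text{ for some } N \text{ and some } H_1,\dots,H_N\in\mathbb{R}[x,y]\Big\}.$$ Let $I_{2n}(f)\subset\mathbb{R}[x,y]$ be the ideal generated by $\mathrm{Denom}_{2n}(f)$. The set of bad points of order $2n$ of $f$, $\mathrm{Bad}_{2n}(f)\subset\mathbb{R}^2$, is the set of real zeros of $I_{2n}(f)$, i.e. the common zero set in $\mathbb{R}^2$ of all $G\in\mathrm{Denom}_{2n}(f)$. Codimension is the codimension in $\mathbb{R}^2$ of a real algebraic set; codimension equal to $2$ means that the set is non-empty and of dimension $0$ (the empty set does not have codimension $2$). *)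

theory Defs
  imports
    "HOL-Library.Extended_Real"
    "HOL-Computational_Algebra.Polynomial"
    "HOL-Computational_Algebra.Fraction_Field"
    "HOL-Algebra.QuotRing"
    "HOL-Decision_Procs.Algebra_Aux"
begin

text \<open>
  \<open>\<real>[x,y]\<close> is rendered as \<open>\<real>[x][y]\<close>, i.e. the type \<open>real poly poly\<close> whose outer
  variable is \<open>y\<close>; its field of fractions \<open>\<real>(x,y)\<close> is \<open>real poly poly fract\<close>.  The constant
  \<open>cring_class_ops\<close> is the type-class ring seen as a HOL-Algebra ring with carrier \<open>UNIV\<close>, so
  that the library's ideals, prime ideals and quotient rings apply.
\<close>

abbreviation Rxy :: "real poly poly ring" where
  "Rxy \<equiv> cring_class_ops"

definition eval2 :: "real poly poly \<Rightarrow> real \<times> real \<Rightarrow> real" where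
  "eval2 G p = poly (poly G [:snd p:]) (fst p)"

text \<open>Here and below the parameter \<open>m\<close> is the exponent itself (\<open>2n\<close> in the usual notation).\<close>

definition Denom :: "nat \<Rightarrow> real poly poly \<Rightarrow> real poly poly set" where
  "Denom m f = {G. \<exists>(N::nat) (H :: nat \<Rightarrow> real poly poly). G ^ m * f = (\<Sum>i<N. H i ^ m)}"

definition denom_ideal :: "nat \<Rightarrow> real poly poly \<Rightarrow> real poly poly set" where
  "denom_ideal m f = Idl\<^bsub>Rxy\<^esub> (Denom m f)"

definition real_zeros :: "real poly poly set \<Rightarrow> (real \<times> real) set" where
  "real_zeros I = {p. \<forall>G\<in>I. eval2 G p = 0}"

definition Bad :: "nat \<Rightarrow> real poly poly \<Rightarrow> (real \<times> real) set" where
  "Bad m f = real_zeros (denom_ideal m f)"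

definition sum_of_powers_rat :: "nat \<Rightarrow> real poly poly \<Rightarrow> bool" where
  "sum_of_powers_rat m f \<longleftrightarrow>
     (\<exists>(N::nat) (r :: nat \<Rightarrow> real poly poly fract). Fract f 1 = (\<Sum>i<N. r i ^ m))"

text \<open>
  The Krull dimension takes values in the extended reals, so that the zero ring, which has no
  prime ideals, gets the value \<open>Sup {} = -\<infinity>\<close>.
\<close>

definition krull_dim :: "('a, 'b) ring_scheme \<Rightarrow> ereal" where
  "krull_dim R = Sup {ereal (real k) | k :: nat.
     \<exists>P :: nat \<Rightarrow> 'a set. (\<forall>i\<le>k. primeideal (P i) R) \<and> (\<forall>i<k. P i \<subset> P (Suc i))}"

definition vanishing_ideal :: "(real \<times> real) set \<Rightarrow> real poly poly set" where
  "vanishing_ideal V = {G. \<forall>p\<in>V. eval2 G p = 0}"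

text \<open>
  The dimension of a real algebraic set \<open>V\<close> is the Krull dimension of its coordinate ring
  \<open>\<real>[x,y] / I(V)\<close>.  For \<open>V = {}\<close> the dimension is \<open>-\<infinity>\<close> and hence the codimension is \<open>\<infinity>\<close>.
\<close>

definition alg_dim :: "(real \<times> real) set \<Rightarrow> ereal" where
  "alg_dim V = krull_dim (Rxy Quot (vanishing_ideal V))"

definition codim :: "(real \<times> real) set \<Rightarrow> ereal" where
  "codim V = 2 - alg_dim V"

end

theory Submission
  imports Defs "HOL-Analysis.Convex"
begin

text \<open>
  With \<open>z = x + iy\<close> take \<open>f = C(2N,N) |z|\<^sup>2\<^sup>n + C(2N,N+n) Re (z\<^sup>2\<^sup>n)\<close> for \<open>N = n(2k+1)\<close> and \<open>k\<close>
  large.  Averaging the powers \<open>(2 Re (z exp (-ia)))\<^sup>2\<^sup>N\<close> over equidistant angles \<open>a\<close> with the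
  nonnegative weights \<open>1 + cos (2na)\<close> yields \<open>|z|\<^sup>4\<^sup>n\<^sup>k f\<close>, and \<open>2N\<close>th powers are \<open>2n\<close>th powers.  So
  \<open>(x\<^sup>2 + y\<^sup>2)\<^sup>k\<close> is a denominator and only the origin can be bad.  If some denominator did not
  vanish at the origin, comparing the forms of lowest degree would make \<open>f\<close> a sum of \<open>2n\<close>th
  powers of linear forms, hence convex.  But relative to \<open>C(2N,N)\<close>, as \<open>k\<close> grows, \<open>f\<close> tends
  to \<open>0\<close> at \<open>exp (\<plusminus>i\<pi>/2n)\<close> and to a positive number at their midpoint, as \<open>n > 1\<close>.
\<close>

section \<open>Evaluation of bivariate polynomials\<close>

lemma eval2_simps [simp]:
  "eval2 0 p = 0" "eval2 1 p = 1" "eval2 [:[:c:]:] p = c"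
  "eval2 [:[:0, 1:]:] p = fst p" "eval2 [:0, 1:] p = snd p"
  "eval2 (F + G) p = eval2 F p + eval2 G p"
  "eval2 (F - G) p = eval2 F p - eval2 G p"
  "eval2 (- F) p = - eval2 F p"
  "eval2 (F * G) p = eval2 F p * eval2 G p"
  "eval2 (F ^ k) p = eval2 F p ^ k"
  by (simp_all add: eval2_def)

lemma eval2_sum [simp]: "eval2 (sum h A) p = (\<Sum>i\<in>A. eval2 (h i) p)"
  by (simp add: eval2_def poly_sum)

lemma eval2_pCons: "eval2 (pCons a B) p = poly a (fst p) + snd p * eval2 B p"
  by (simp add: eval2_def)

text \<open>Seen as a polynomial in the outer variable over the domain of polynomials in x, a
  nonzero \<open>F - G\<close> has finitely many roots, while every constant \<open>[:y:]\<close>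
  would be one.\<close>

lemma eval2_eqI:
  assumes "\<And>x y. eval2 F (x, y) = eval2 G (x, y)"
  shows "F = G"
proof (rule ccontr)
  assume "F \<noteq> G"
  then have "finite {c. poly (F - G) c = 0}"
    by (intro poly_roots_finite) simp
  moreover have "poly F [:y:] = poly G [:y:]" for y
    using assms by (simp add: eval2_def poly_eq_poly_eq_iff[symmetric] fun_eq_iff)
  then have "range (\<lambda>y. [:y:]) \<subseteq> {c. poly (F - G) c = 0}"
    by auto
  moreover have "infinite (range (\<lambda>y::real. [:y:]))"
    by (subst finite_image_iff) (auto simp: inj_on_def infinite_UNIV_char_0)
  ultimately show False
    using finite_subset by blast
qed

lemma tendsto_eval2:
  assumes "(a \<longlongrightarrow> x) F" "(b \<longlongrightarrow> y) F"
  shows "((\<lambda>t. eval2 G (a t, b t)) \<longlongrightarrow> eval2 G (x, y)) F"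
proof (induction G)
  case 0
  then show ?case by simp
next
  case (pCons c B)
  then show ?case
    unfolding eval2_pCons using assms by (auto intro!: tendsto_intros)
qed

text \<open>Without constant term, \<open>H\<close> has the form x \<open>A\<close>(x) + y
  \<open>B\<close>(x, y), and division by \<open>t\<close> along a ray leaves a polynomial. The
  limit is the linear part of \<open>H\<close>, with \<open>a\<close> and \<open>b\<close>
  independent of the direction.\<close>

lemma eval2_directional_derivative:
  assumes "eval2 H (0, 0) = 0"
  obtains a b where "\<And>x y. ((\<lambda>t. eval2 H (t * x, t * y) / t) \<longlongrightarrow> a * x + b * y) (at 0)"
proof -
  obtain h B where H: "H = pCons h B" by (cases H)
  obtain c A where h: "h = pCons c A" by (cases h)
  have c: "c = 0"
    using assms by (simp add: H h eval2_pCons)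
  have "((\<lambda>t. eval2 H (t * x, t * y) / t) \<longlongrightarrow> poly A 0 * x + eval2 B (0, 0) * y) (at 0)" for x y
  proof (rule Lim_transform_eventually)
    have "((\<lambda>t. x * poly A (t * x) + y * eval2 B (t * x, t * y))
            \<longlongrightarrow> x * poly A (0 * x) + y * eval2 B (0 * x, 0 * y)) (at 0)"
      by (intro tendsto_intros tendsto_eval2)
    then show "((\<lambda>t. x * poly A (t * x) + y * eval2 B (t * x, t * y))
            \<longlongrightarrow> poly A 0 * x + eval2 B (0, 0) * y) (at 0)"
      by (simp add: mult.commute)
    show "\<forall>\<^sub>F t in at 0. x * poly A (t * x) + y * eval2 B (t * x, t * y)
            = eval2 H (t * x, t * y) / t"
      by (auto simp: eventually_at_filter H h c eval2_pCons field_simps)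
  qed
  then show thesis by (rule that)
qed

text \<open>Multiplying by x + iy mixes real and imaginary parts, so the induction builds both at
  once.\<close>

lemma complex_power_as_polynomials:
  obtains A B where "\<And>x y. Complex (eval2 A (x, y)) (eval2 B (x, y)) = Complex x y ^ m"
proof -
  have "\<exists>A B. \<forall>x y. Complex (eval2 A (x, y)) (eval2 B (x, y)) = Complex x y ^ m"
  proof (induction m)
    case 0
    have "Complex (eval2 1 (x, y)) (eval2 0 (x, y)) = 1" for x y
      by (simp add: complex_eq_iff)
    then show ?case unfolding power_0 by blast
  next
    case (Suc m)
    then obtain A B where AB: "\<And>x y. Complex (eval2 A (x, y)) (eval2 B (x, y)) = Complex x y ^ m"
      by blast
    let ?X = "[:[:0, 1:]:] :: real poly poly" and ?Y = "[:0, 1:] :: real poly poly"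
    have "Complex (eval2 (?X * A - ?Y * B) (x, y)) (eval2 (?X * B + ?Y * A) (x, y))
            = Complex x y ^ Suc m" for x y
      unfolding power_Suc AB[symmetric] by (simp add: complex_eq_iff del: mult_pCons_left)
    then show ?case by blast
  qed
  then show thesis using that by blast
qed

section \<open>Codimension of a point\<close>

lemma ideal_vanishing_ideal: "ideal (vanishing_ideal V) Rxy"
proof (rule idealI)
  show "ring Rxy" by (rule cring.axioms(1)[OF cring_class])
  show "subgroup (vanishing_ideal V) (add_monoid Rxy)"
  proof (rule group.subgroupI)
    show "Group.group (add_monoid Rxy)"
      by (rule abelian_group.a_group[OF cring_class.abelian_group_axioms])
    show "vanishing_ideal V \<noteq> {}"
      by (auto simp: vanishing_ideal_def intro: exI[of _ 0])
    show "inv\<^bsub>add_monoid Rxy\<^esub> a \<in> vanishing_ideal V" if "a \<in> vanishing_ideal V" for a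
      using that uminus_class[of a] by (simp add: a_inv_def vanishing_ideal_def)
  qed (auto simp: vanishing_ideal_def class_simps)
qed (auto simp: vanishing_ideal_def class_simps)

text \<open>Vanishing at \<open>p\<close> defines an ideal, so it passes from the generators to
  everything they generate.\<close>

lemma denom_ideal_vanishes:
  assumes "\<And>G. G \<in> Denom m f \<Longrightarrow> eval2 G p = 0" "G \<in> denom_ideal m f"
  shows "eval2 G p = 0"
proof -
  have "Denom m f \<subseteq> vanishing_ideal {p}"
    using assms(1) by (auto simp: vanishing_ideal_def)
  then have "denom_ideal m f \<subseteq> vanishing_ideal {p}"
    unfolding denom_ideal_def
    by (rule ring.genideal_minimal[OF cring.axioms(1)[OF cring_class] ideal_vanishing_ideal])
  with assms(2) show ?thesis by (auto simp: vanishing_ideal_def)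
qed

lemma Denom_subset_denom_ideal: "Denom m f \<subseteq> denom_ideal m f"
  unfolding denom_ideal_def
  by (rule ring.genideal_self[OF cring.axioms(1)[OF cring_class]]) (simp add: class_simps subset_iff)

lemma maximalideal_vanishing_point: "maximalideal (vanishing_ideal {p}) Rxy"
proof (rule maximalidealI)
  have "1 \<notin> vanishing_ideal {p}" by (simp add: vanishing_ideal_def)
  then show "carrier Rxy \<noteq> vanishing_ideal {p}"
    using carrier_class by metis
next
  fix J
  assume J: "ideal J Rxy" and sub: "vanishing_ideal {p} \<subseteq> J"
  interpret J: ideal J Rxy by (rule J)
  show "J = vanishing_ideal {p} \<or> J = carrier Rxy"
  proof (cases "J = vanishing_ideal {p}")
    case False
    then obtain g where g: "g \<in> J" "eval2 g p \<noteq> 0"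
      using sub by (auto simp: vanishing_ideal_def)
    \<comment> \<open>Rescaled to take the value 1 at \<open>p\<close>, \<open>g\<close> differs
      from 1 by an element vanishing at \<open>p\<close>; hence 1 lies in \<open>J\<close>.\<close>
    have "1 - [:[:1 / eval2 g p:]:] * g \<in> J"
      using g sub by (auto simp: vanishing_ideal_def simp del: mult_pCons_left)
    moreover have "[:[:1 / eval2 g p:]:] * g \<in> J"
      using J.I_l_closed[OF g(1), of "[:[:1 / eval2 g p:]:]"] by (simp add: class_simps)
    ultimately have "(1 - [:[:1 / eval2 g p:]:] * g) + [:[:1 / eval2 g p:]:] * g \<in> J"
      using J.a_closed by (metis plus_class)
    then have "\<one>\<^bsub>Rxy\<^esub> \<in> J" by (simp add: class_simps)
    then show ?thesis using J.one_imp_carrier by simp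
  qed simp
qed (rule ideal_vanishing_ideal)

lemma (in field) primeideal_iff_zero: "primeideal P R \<longleftrightarrow> P = {\<zero>}"
proof
  assume P: "primeideal P R"
  then have "P \<in> {I. ideal I R}" by (simp add: primeideal.axioms(1))
  then show "P = {\<zero>}"
    using all_ideals primeideal.I_notcarr[OF P] by auto
qed (simp add: zeroprimeideal)

text \<open>The zero ideal is the only prime, so chains of length 0 exist and no longer ones
  do.\<close>

lemma (in field) krull_dim_field: "krull_dim R = 0"
proof -
  have "{ereal (real k) | k. \<exists>P. (\<forall>i\<le>k. primeideal (P i) R) \<and> (\<forall>i<k. P i \<subset> P (Suc i))} = {0}"
    (is "?S = _")
  proof (intro equalityI subsetI)
    fix d assume "d \<in> ?S"
    then obtain k P where d: "d = ereal (real k)"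
      and P: "\<forall>i\<le>k. primeideal (P i) R" "\<forall>i<k. P i \<subset> P (Suc i)" by blast
    have "k = 0"
    proof (rule ccontr)
      assume "k \<noteq> 0"
      then have "P 0 \<subset> P (Suc 0)" "P 0 = {\<zero>}" "P (Suc 0) = {\<zero>}"
        using P by (auto simp: primeideal_iff_zero)
      then show False by simp
    qed
    then show "d \<in> {0}" by (simp add: d zero_ereal_def)
  next
    fix d :: ereal assume "d \<in> {0}"
    then have "d = ereal (real 0)" by (simp add: zero_ereal_def)
    moreover have "\<exists>P. (\<forall>i\<le>0::nat. primeideal (P i) R) \<and> (\<forall>i<0::nat. P i \<subset> P (Suc i))"
      using zeroprimeideal by (intro exI[of _ "\<lambda>_. {\<zero>}"]) simp
    ultimately show "d \<in> ?S" by blast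
  qed
  then show ?thesis by (simp add: krull_dim_def)
qed

text \<open>The coordinate ring of a point is the quotient by a maximal ideal, hence a field of
  dimension 0.\<close>

lemma codim_point: "codim {p} = 2"
proof -
  have "field (Rxy Quot vanishing_ideal {p})"
    by (rule maximalideal.quotient_is_field[OF maximalideal_vanishing_point cring_class])
  then show ?thesis
    by (simp add: codim_def alg_dim_def field.krull_dim_field)
qed

section \<open>Denominators that do not vanish at the origin\<close>

text \<open>Evaluate the identity at (tx, ty), divide by t^(2m) and let t tend to 0. Homogeneity
  keeps \<open>f\<close> unchanged, \<open>G\<close> tends to its value at the origin, and each
  \<open>H i\<close> contributes its linear part.\<close>

lemma homogeneous_sum_of_powers_linear_forms:
  assumes "m > 0"
    and hom: "\<And>t x y. eval2 f (t * x, t * y) = t ^ (2 * m) * eval2 f (x, y)"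
    and G: "G ^ (2 * m) * f = (\<Sum>i<N. H i ^ (2 * m))"
  obtains a b :: "nat \<Rightarrow> real" where
    "\<And>x y. eval2 G (0, 0) ^ (2 * m) * eval2 f (x, y) = (\<Sum>i<N. (a i * x + b i * y) ^ (2 * m))"
proof -
  have eq: "eval2 G p ^ (2 * m) * eval2 f p = (\<Sum>i<N. eval2 (H i) p ^ (2 * m))" for p
    using arg_cong[OF G, of "\<lambda>F. eval2 F p"] by simp
  have "eval2 f (0, 0) = 0"
    using hom[of 0 0 0] \<open>m > 0\<close> by (simp add: power_0_left)
  then have "(\<Sum>i<N. eval2 (H i) (0, 0) ^ (2 * m)) = 0"
    using eq[of "(0, 0)"] by simp
  \<comment> \<open>A vanishing sum of even powers forces each term to vanish.\<close>
  then have H0: "\<forall>i<N. eval2 (H i) (0, 0) = 0"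
    using \<open>m > 0\<close> by (subst (asm) sum_nonneg_eq_0_iff) auto
  \<comment> \<open>The pair \<open>c\<close> is quantified before \<open>x\<close> and
    \<open>y\<close>, so that one linear form per index serves all directions.\<close>
  have "\<forall>i\<in>{..<N}. \<exists>c. \<forall>x y.
      ((\<lambda>t. eval2 (H i) (t * x, t * y) / t) \<longlongrightarrow> fst c * x + snd c * y) (at 0)"
  proof
    fix i assume "i \<in> {..<N}"
    then obtain a b where "\<And>x y.
        ((\<lambda>t. eval2 (H i) (t * x, t * y) / t) \<longlongrightarrow> a * x + b * y) (at 0)"
      using eval2_directional_derivative[of "H i"] H0 by blast
    then show "\<exists>c. \<forall>x y.
        ((\<lambda>t. eval2 (H i) (t * x, t * y) / t) \<longlongrightarrow> fst c * x + snd c * y) (at 0)"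
      by (intro exI[of _ "(a, b)"]) simp
  qed
  from bchoice[OF this] obtain c where c: "\<forall>i\<in>{..<N}. \<forall>x y.
      ((\<lambda>t. eval2 (H i) (t * x, t * y) / t) \<longlongrightarrow> fst (c i) * x + snd (c i) * y) (at 0)" ..
  define a where "a = fst \<circ> c"
  define b where "b = snd \<circ> c"
  have ab: "((\<lambda>t. eval2 (H i) (t * x, t * y) / t) \<longlongrightarrow> a i * x + b i * y) (at 0)" if "i < N" for i x y
    using c that by (simp add: a_def b_def)
  have "eval2 G (0, 0) ^ (2 * m) * eval2 f (x, y) = (\<Sum>i<N. (a i * x + b i * y) ^ (2 * m))" for x y
  proof (rule tendsto_unique)
    show "at (0::real) \<noteq> bot" by simp
    have "((\<lambda>t. eval2 G (t * x, t * y)) \<longlongrightarrow> eval2 G (0 * x, 0 * y)) (at 0)"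
      by (intro tendsto_eval2 tendsto_intros)
    then show "((\<lambda>t. eval2 G (t * x, t * y) ^ (2 * m) * eval2 f (x, y))
        \<longlongrightarrow> eval2 G (0, 0) ^ (2 * m) * eval2 f (x, y)) (at 0)"
      by (intro tendsto_intros) simp
    show "((\<lambda>t. eval2 G (t * x, t * y) ^ (2 * m) * eval2 f (x, y))
        \<longlongrightarrow> (\<Sum>i<N. (a i * x + b i * y) ^ (2 * m))) (at 0)"
    proof (rule Lim_transform_eventually)
      show "((\<lambda>t. \<Sum>i<N. (eval2 (H i) (t * x, t * y) / t) ^ (2 * m))
          \<longlongrightarrow> (\<Sum>i<N. (a i * x + b i * y) ^ (2 * m))) (at 0)"
        using ab by (intro tendsto_intros) auto
      have "(\<Sum>i<N. (eval2 (H i) (t * x, t * y) / t) ^ (2 * m))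
          = eval2 G (t * x, t * y) ^ (2 * m) * eval2 f (x, y)" if "t \<noteq> 0" for t
      proof -
        have "(\<Sum>i<N. (eval2 (H i) (t * x, t * y) / t) ^ (2 * m))
            = (eval2 G (t * x, t * y) ^ (2 * m) * eval2 f (t * x, t * y)) / t ^ (2 * m)"
          by (simp add: eq power_divide sum_divide_distrib)
        with that show ?thesis by (simp add: hom)
      qed
      then show "\<forall>\<^sub>F t in at 0. (\<Sum>i<N. (eval2 (H i) (t * x, t * y) / t) ^ (2 * m))
          = eval2 G (t * x, t * y) ^ (2 * m) * eval2 f (x, y)"
        by (simp add: eventually_at_filter)
    qed
  qed
  then show thesis by (rule that)
qed

lemma midpoint_power_even:
  fixes u v :: real
  shows "2 * ((u + v) / 2) ^ (2 * m) \<le> u ^ (2 * m) + v ^ (2 * m)"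
  using convex_onD[OF convex_power_even[of "2 * m"], of "1 / 2" u v]
  by (simp add: add_divide_distrib)

text \<open>Otherwise a positive multiple of \<open>f\<close> is a sum of even powers of linear
  forms, hence convex, whereas \<open>nonconvex\<close> violates midpoint convexity on the segment
  from (c, -s) to (c, s).\<close>

lemma denominator_vanishes_at_origin:
  assumes "m > 0"
    and hom: "\<And>t x y. eval2 f (t * x, t * y) = t ^ (2 * m) * eval2 f (x, y)"
    and nonconvex: "eval2 f (c, s) + eval2 f (c, - s) < 2 * eval2 f (c, 0)"
    and "G \<in> Denom (2 * m) f"
  shows "eval2 G (0, 0) = 0"
proof (rule ccontr)
  assume nz: "eval2 G (0, 0) \<noteq> 0"
  obtain N H where "G ^ (2 * m) * f = (\<Sum>i<(N::nat). H i ^ (2 * m))"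
    using assms(4) by (auto simp: Denom_def)
  from homogeneous_sum_of_powers_linear_forms[OF assms(1) hom this]
  obtain a b :: "nat \<Rightarrow> real" where ab: "\<And>x y. eval2 G (0, 0) ^ (2 * m) * eval2 f (x, y)
      = (\<Sum>i<N. (a i * x + b i * y) ^ (2 * m))" by blast
  have "eval2 G (0, 0) ^ (2 * m) * (2 * eval2 f (c, 0))
      = (\<Sum>i<N. 2 * (((a i * c + b i * s) + (a i * c + b i * - s)) / 2) ^ (2 * m))"
    unfolding mult.left_commute[of _ 2] ab sum_distrib_left by (simp add: mult.commute)
  also have "\<dots> \<le> (\<Sum>i<N. (a i * c + b i * s) ^ (2 * m) + (a i * c + b i * - s) ^ (2 * m))"
    by (intro sum_mono midpoint_power_even)
  also have "\<dots> = eval2 G (0, 0) ^ (2 * m) * (eval2 f (c, s) + eval2 f (c, - s))"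
    unfolding distrib_left ab sum.distrib ..
  finally show False
    using nz nonconvex by (simp add: mult_le_cancel_left zero_less_power_eq)
qed

section \<open>Averaging powers of linear forms\<close>

text \<open>For nonzero \<open>q\<close> this is a full geometric sum of an \<open>M\<close>th root
  of unity \<open>w\<close>. The bound on \<open>q\<close> excludes nonzero multiples of
  \<open>M\<close>, so \<open>w\<close> is not 1.\<close>

lemma sum_roots_of_unity_power:
  fixes q :: int
  assumes "\<bar>q\<bar> < int M"
  shows "(\<Sum>l<M. cis (of_int q * (2 * pi * real l / real M))) = (if q = 0 then of_nat M else 0)"
proof (cases "q = 0")
  case False
  have M: "M > 0" using assms by simp
  define w where "w = cis (of_int q * (2 * pi / real M))"
  have pow: "cis (of_int q * (2 * pi * real l / real M)) = w ^ l" for l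
    by (simp add: w_def DeMoivre mult_ac)
  have "w ^ M = cis (2 * pi * of_int q)"
    using M by (simp add: w_def DeMoivre mult_ac)
  then have wM: "w ^ M = 1" by simp
  have "w \<noteq> 1"
  proof
    assume "w = 1"
    then have "cos (of_int q * (2 * pi / real M)) = 1"
      by (simp add: w_def complex_eq_iff)
    then obtain j :: int where "of_int q * (2 * pi / real M) = of_int j * 2 * pi"
      unfolding cos_one_2pi_int by blast
    then have "of_int q = (of_int (j * int M) :: real)"
      using M by (simp add: field_simps)
    then have "q = j * int M" by linarith
    with assms False show False
      by (auto simp: abs_mult mult_less_cancel_right2)
  qed
  then have "(\<Sum>l<M. w ^ l) = 0"
    using wM by (simp add: geometric_sum)
  with False show ?thesis by (simp only: pow if_False)
qed simp

lemma double_cos_power_expansion: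
  "complex_of_real ((2 * cos b) ^ k) = (\<Sum>j\<le>k. of_nat (k choose j) * cis ((2 * real j - real k) * b))"
proof -
  have "complex_of_real (2 * cos b) = cis b + cis (- b)"
    by (simp add: complex_eq_iff)
  then have "complex_of_real ((2 * cos b) ^ k) = (cis b + cis (- b)) ^ k"
    by (simp only: of_real_power)
  also have "\<dots> = (\<Sum>j\<le>k. of_nat (k choose j) * cis b ^ j * cis (- b) ^ (k - j))"
    by (rule binomial_ring)
  also have "\<dots> = (\<Sum>j\<le>k. of_nat (k choose j) * cis ((2 * real j - real k) * b))"
    by (intro sum.cong) (auto simp: DeMoivre cis_mult of_nat_diff algebra_simps)
  finally show ?thesis .
qed

text \<open>Discrete orthogonality: the power of the cosine has frequencies 2j - 2N, and the weight
  selects 0 and \<plusminus>2n among them. The bound on \<open>M\<close> prevents aliasing after the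
  shift by 2n.\<close>

lemma averaged_cos_powers:
  assumes n: "0 < n" "n \<le> N" and M: "2 * N + 2 * n < M"
  defines "\<alpha> \<equiv> \<lambda>l. 2 * pi * real l / real M"
  shows "(\<Sum>l<M. (1 + cos (2 * real n * \<alpha> l)) * (2 * cos (\<theta> - \<alpha> l)) ^ (2 * N))
    = real M * (real (2 * N choose N) + real (2 * N choose (N + n)) * cos (2 * real n * \<theta>))"
proof -
  let ?b = "\<lambda>j. of_nat (2 * N choose j) :: complex"
  let ?e = "\<lambda>j. cis ((2 * real j - real (2 * N)) * \<theta>)"
  let ?d = "\<lambda>j k. if j = k then 1 else 0 :: complex"
  have cos_cis: "complex_of_real (1 + cos x) = 1 + (cis x + cis (- x)) / 2" for x
    by (simp add: complex_eq_iff)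
  have regroup: "u * (w * (d + (d' + d'') / 2)) = w * (d * u + (d' * u + d'' * u) / 2)"
    for u w d d' d'' :: complex
    by (simp add: field_simps)
  have weight: "(\<Sum>l<M. complex_of_real (1 + cos (2 * real n * \<alpha> l)) * cis ((2 * real N - 2 * real j) * \<alpha> l))
      = of_nat M * (?d j N + (?d j (N + n) + ?d j (N - n)) / 2)" if "j \<le> 2 * N" for j
  proof -
    \<comment> \<open>An integer frequency, as \<open>sum_roots_of_unity_power\<close> requires; its
      zero and its two shifted zeros are at j = N, N + n and N - n.\<close>
    define q where "q = 2 * int N - 2 * int j"
    have q: "2 * real N - 2 * real j = of_int q" by (simp add: q_def)
    have "(\<Sum>l<M. complex_of_real (1 + cos (2 * real n * \<alpha> l)) * cis (of_int q * \<alpha> l))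
      = (\<Sum>l<M. cis (of_int q * \<alpha> l)) + ((\<Sum>l<M. cis (of_int (q + 2 * int n) * \<alpha> l))
          + (\<Sum>l<M. cis (of_int (q - 2 * int n) * \<alpha> l))) / 2"
      unfolding cos_cis
      by (simp add: distrib_right cis_mult sum.distrib add_divide_distrib sum_divide_distrib
          algebra_simps)
    also have "\<dots> = (if q = 0 then of_nat M else 0) + ((if q + 2 * int n = 0 then of_nat M else 0)
          + (if q - 2 * int n = 0 then of_nat M else 0)) / 2"
    proof -
      have "\<bar>q\<bar> < int M" "\<bar>q + 2 * int n\<bar> < int M" "\<bar>q - 2 * int n\<bar> < int M"
        using that M by (auto simp: q_def)
      then show ?thesis unfolding \<alpha>_def by (simp only: sum_roots_of_unity_power)
    qed
    also have "\<dots> = of_nat M * (?d j N + (?d j (N + n) + ?d j (N - n)) / 2)"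
      using n by (auto simp: q_def)
    finally show ?thesis by (simp only: q)
  qed
  have "complex_of_real (\<Sum>l<M. (1 + cos (2 * real n * \<alpha> l)) * (2 * cos (\<theta> - \<alpha> l)) ^ (2 * N))
    = (\<Sum>l<M. \<Sum>j\<le>2 * N. ?b j * ?e j *
        (complex_of_real (1 + cos (2 * real n * \<alpha> l)) * cis ((2 * real N - 2 * real j) * \<alpha> l)))"
    unfolding of_real_sum of_real_mult[of "1 + cos _"] double_cos_power_expansion sum_distrib_left
  proof (intro sum.cong refl)
    fix l j
    have "cis ((2 * real j - real (2 * N)) * (\<theta> - \<alpha> l))
        = ?e j * cis ((2 * real N - 2 * real j) * \<alpha> l)"
      by (simp add: cis_mult algebra_simps)
    then show "complex_of_real (1 + cos (2 * real n * \<alpha> l)) *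
        (?b j * cis ((2 * real j - real (2 * N)) * (\<theta> - \<alpha> l))) = ?b j * ?e j *
        (complex_of_real (1 + cos (2 * real n * \<alpha> l)) * cis ((2 * real N - 2 * real j) * \<alpha> l))"
      by (simp only: mult_ac)
  qed
  also have "\<dots> = (\<Sum>j\<le>2 * N. ?b j * ?e j * (of_nat M * (?d j N + (?d j (N + n) + ?d j (N - n)) / 2)))"
    by (subst sum.swap, intro sum.cong refl, subst sum_distrib_left[symmetric], subst weight) auto
  also have "\<dots> = of_nat M * (\<Sum>j\<le>2 * N. ?d j N * (?b j * ?e j)
      + (?d j (N + n) * (?b j * ?e j) + ?d j (N - n) * (?b j * ?e j)) / 2)"
    by (simp only: sum_distrib_left[of "of_nat M"] regroup)
  also have "\<dots> = of_nat M * (?b N * ?e N + (?b (N + n) * ?e (N + n) + ?b (N - n) * ?e (N - n)) / 2)"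
    using n by (simp add: sum.distrib sum_divide_distrib[symmetric] if_distrib[of "\<lambda>c. c * _"]
        sum.delta cong: if_cong)
  \<comment> \<open>Equal coefficients let the two outer exponentials combine into a cosine.\<close>
  also have "?b (N - n) = ?b (N + n)"
    using n binomial_symmetric[of "N + n" "2 * N"] by simp
  also have "?e N = 1" by simp
  also have "?e (N + n) = cis (2 * real n * \<theta>)" by simp
  also have "?e (N - n) = cis (- (2 * real n * \<theta>))"
    using n by (simp add: of_nat_diff)
  also have "of_nat M * (?b N * 1 + (?b (N + n) * cis (2 * real n * \<theta>)
        + ?b (N + n) * cis (- (2 * real n * \<theta>))) / 2)
      = complex_of_real (real M * (real (2 * N choose N) + real (2 * N choose (N + n)) * cos (2 * real n * \<theta>)))"
    by (simp add: complex_eq_iff)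
  finally show ?thesis by (simp only: of_real_eq_iff)
qed

text \<open>In polar coordinates the linear form at angle \<open>\<alpha> l\<close> is r
  cos(\<theta> - \<open>\<alpha> l\<close>), so this is \<open>averaged_cos_powers\<close>
  multiplied by r^(2N).\<close>

lemma averaged_linear_form_powers:
  assumes n: "0 < n" "n \<le> N" and M: "2 * N + 2 * n < M"
  defines "\<alpha> \<equiv> \<lambda>l. 2 * pi * real l / real M"
  shows "(\<Sum>l<M. (1 + cos (2 * real n * \<alpha> l)) * (2 * (cos (\<alpha> l) * x + sin (\<alpha> l) * y)) ^ (2 * N))
    = real M * (x\<^sup>2 + y\<^sup>2) ^ (N - n) * (real (2 * N choose N) * (x\<^sup>2 + y\<^sup>2) ^ n
        + real (2 * N choose (N + n)) * Re (Complex x y ^ (2 * n)))"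
proof -
  obtain r \<theta> where r: "Complex x y = rcis r \<theta>" using rcis_Ex by metis
  then have x: "x = r * cos \<theta>" and y: "y = r * sin \<theta>"
    by (simp_all add: complex_eq_iff)
  have r2: "x\<^sup>2 + y\<^sup>2 = r\<^sup>2"
    by (simp add: x y power_mult_distrib distrib_left[symmetric])
  have rN: "r ^ (2 * N) = (x\<^sup>2 + y\<^sup>2) ^ (N - n) * r ^ (2 * n)"
    using n by (simp add: r2 power_mult[symmetric] power_add[symmetric] diff_mult_distrib2)
  have "2 * (cos (\<alpha> l) * x + sin (\<alpha> l) * y) = r * (2 * cos (\<theta> - \<alpha> l))" for l
    by (simp add: x y cos_diff algebra_simps)
  then have "(\<Sum>l<M. (1 + cos (2 * real n * \<alpha> l)) * (2 * (cos (\<alpha> l) * x + sin (\<alpha> l) * y)) ^ (2 * N))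
    = r ^ (2 * N) * (\<Sum>l<M. (1 + cos (2 * real n * \<alpha> l)) * (2 * cos (\<theta> - \<alpha> l)) ^ (2 * N))"
    unfolding sum_distrib_left
    by (intro sum.cong refl) (simp only: power_mult_distrib[of r] mult_ac)
  also have "\<dots> = r ^ (2 * N) * (real M * (real (2 * N choose N) + real (2 * N choose (N + n)) * cos (2 * real n * \<theta>)))"
    unfolding \<alpha>_def by (simp only: averaged_cos_powers[OF n M])
  also have "\<dots> = real M * (x\<^sup>2 + y\<^sup>2) ^ (N - n) * (real (2 * N choose N) * r ^ (2 * n)
        + real (2 * N choose (N + n)) * (r ^ (2 * n) * cos (2 * real n * \<theta>)))"
    unfolding rN by (simp only: algebra_simps)
  also have "r ^ (2 * n) * cos (2 * real n * \<theta>) = Re (Complex x y ^ (2 * n))"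
    by (simp add: r DeMoivre2)
  also have "r ^ (2 * n) = (x\<^sup>2 + y\<^sup>2) ^ n"
    by (simp add: r2 power_mult)
  finally show ?thesis .
qed

text \<open>Consecutive coefficients have ratio 1 - (2j + 1)/(N + j + 1), so a step loses at most
  (2j + 1)/(N + 1) times the central one. The odd numbers add up to j^2. For fixed \<open>j\<close>,
  the quotient by the central coefficient thus tends to 1 as \<open>N\<close> grows.\<close>

lemma central_binomial_neighbour_bound:
  assumes "j \<le> N"
  shows "(1 - real (j\<^sup>2) / (real N + 1)) * real (2 * N choose N) \<le> real (2 * N choose (N + j))"
  using assms
proof (induction j)
  case 0
  then show ?case by simp
next
  case (Suc j)
  let ?C = "real (2 * N choose N)" and ?B = "real (2 * N choose (N + j))"
  have "Suc (N + j) * (2 * N choose Suc (N + j)) = (2 * N - (N + j)) * (2 * N choose (N + j))"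
    by (metis binomial_absorb_comp binomial_absorption)
  then have "real (Suc (N + j)) * real (2 * N choose Suc (N + j)) = real (2 * N - (N + j)) * ?B"
    by (metis of_nat_mult)
  then have *: "(real N + real j + 1) * real (2 * N choose Suc (N + j)) = (real N - real j) * ?B"
    using Suc.prems by (simp add: of_nat_diff algebra_simps)
  have "real (2 * N choose Suc (N + j)) = ?B - (2 * real j + 1) / (real N + real j + 1) * ?B"
    using * by (simp add: field_simps)
  moreover have "(2 * real j + 1) / (real N + real j + 1) * ?B \<le> (2 * real j + 1) / (real N + 1) * ?C"
    by (intro mult_mono divide_left_mono) (auto simp: binomial_maximum')
  moreover have "(1 - real (j\<^sup>2) / (real N + 1)) * ?C \<le> ?B"
    using Suc by simp
  ultimately have "(1 - real (j\<^sup>2) / (real N + 1)) * ?C - (2 * real j + 1) / (real N + 1) * ?C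
      \<le> real (2 * N choose (N + Suc j))"
    by simp
  moreover have "(1 - real (j\<^sup>2) / (real N + 1)) * ?C - (2 * real j + 1) / (real N + 1) * ?C
      = (1 - (real (j\<^sup>2) + (2 * real j + 1)) / (real N + 1)) * ?C"
    by (simp only: add_divide_distrib left_diff_distrib distrib_right diff_diff_eq)
  moreover have "real (j\<^sup>2) + (2 * real j + 1) = real ((Suc j)\<^sup>2)"
    by (simp add: power2_eq_square)
  ultimately show ?case by simp
qed

section \<open>The polynomial\<close>

text \<open>Dividing by \<open>G ^ m\<close> exhibits \<open>f\<close> as the sum of the powers of
  \<open>H i\<close> / \<open>G\<close>.\<close>

lemma sum_of_powers_rat_if_Denom:
  assumes "G \<in> Denom m f" "G \<noteq> 0"
  shows "sum_of_powers_rat m f"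
proof -
  obtain N H where eq: "G ^ m * f = (\<Sum>i<(N::nat). H i ^ m)"
    using assms(1) by (auto simp: Denom_def)
  have pow: "Fract a b ^ k = Fract (a ^ k) (b ^ k)" for a b :: "real poly poly" and k
    by (induction k) (simp_all add: One_fract_def)
  have sum: "(\<Sum>i<(N::nat). Fract (h i) b) = Fract (\<Sum>i<N. h i) b" if "b \<noteq> 0"
    for b :: "real poly poly" and h N
    using that
    by (induction N) (auto simp: Zero_fract_def eq_fract algebra_simps)
  have "Fract f 1 = Fract (G ^ m * f) (G ^ m)"
    using assms(2) by (simp add: eq_fract)
  also have "\<dots> = (\<Sum>i<N. Fract (H i) G ^ m)"
    using assms(2) by (simp add: eq pow sum)
  finally show ?thesis unfolding sum_of_powers_rat_def by (intro exI)
qed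

theorem theorem4p3:
  fixes n :: nat
  assumes "n > 1"
  shows "\<exists>f :: real poly poly. sum_of_powers_rat (2 * n) f \<and> codim (Bad (2 * n) f) = 2"
proof -
  let ?\<beta> = "pi / (2 * real n)"
  define \<kappa> where "\<kappa> = cos ?\<beta> ^ (2 * n)"
  \<comment> \<open>Here n > 1 matters: for n = 1 the angle would be pi/2 and
    \<open>\<kappa>\<close> would vanish.\<close>
  have "0 < ?\<beta>" "?\<beta> < pi / 2"
    using assms by (auto simp: field_simps)
  then have "\<kappa> > 0"
    unfolding \<kappa>_def by (intro zero_less_power cos_gt_zero_pi) auto
  obtain k :: nat where k: "real (n\<^sup>2) / \<kappa> < real k"
    using reals_Archimedean2 by blast
  \<comment> \<open>Then 2N = (2k + 1) 2n makes \<open>2 * N\<close>th powers into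
    \<open>2 * n\<close>th powers, and N - n = 2nk does the same for the factor (x^2 + y^2)^(N -
    n).\<close>
  define N where "N = n * (2 * k + 1)"
  define M where "M = 2 * N + 2 * n + 1"
  define \<alpha> where "\<alpha> = (\<lambda>l. 2 * pi * real l / real M)"
  define C0 where "C0 = real (2 * N choose N)"
  define C1 where "C1 = real (2 * N choose (N + n))"
  have n: "0 < n" "n \<le> N" and M: "2 * N + 2 * n < M" "M > 0"
    using assms by (auto simp: N_def M_def)
  have C0: "C0 > 0" and C1: "C1 \<ge> 0" by (simp_all add: C0_def C1_def)
  have "k \<le> N" using n(1) mult_le_mono[of 1 n k "2 * k + 1"] by (simp add: N_def)
  then have "real (n\<^sup>2) / \<kappa> < real N + 1" using k by linarith
  then have "real (n\<^sup>2) / (real N + 1) < \<kappa>"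
    using \<open>\<kappa> > 0\<close> by (simp add: field_simps)
  then have "real (n\<^sup>2) / (real N + 1) * C0 < \<kappa> * C0"
    using C0 by (rule mult_strict_right_mono)
  moreover have "(1 - real (n\<^sup>2) / (real N + 1)) * C0 \<le> C1"
    unfolding C0_def C1_def by (rule central_binomial_neighbour_bound[OF n(2)])
  moreover have "0 \<le> \<kappa> * C1" using \<open>\<kappa> > 0\<close> C1 by simp
  \<comment> \<open>The left side is the value of \<open>f\<close> at angles
    \<plusminus>\<open>?\<beta>\<close>, the right side its value at the midpoint of these two
    points.\<close>
  ultimately have gap: "C0 - C1 < \<kappa> * (C0 + C1)"
    unfolding left_diff_distrib distrib_left by linarith

  let ?X = "[:[:0, 1:]:] :: real poly poly" and ?Y = "[:0, 1:] :: real poly poly"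
  obtain A B where AB: "\<And>x y. Complex (eval2 A (x, y)) (eval2 B (x, y)) = Complex x y ^ (2 * n)"
    using complex_power_as_polynomials by blast
  then have A: "eval2 A (x, y) = Re (Complex x y ^ (2 * n))" for x y
    by (metis complex.sel(1))
  define f where "f = [:[:C0:]:] * (?X\<^sup>2 + ?Y\<^sup>2) ^ n + [:[:C1:]:] * A"
  have f: "eval2 f (x, y) = C0 * (x\<^sup>2 + y\<^sup>2) ^ n + C1 * Re (Complex x y ^ (2 * n))" for x y
    unfolding f_def eval2_simps A by simp
  \<comment> \<open>The root absorbs the nonnegative weight and the factor 1/M of the
    average.\<close>
  define L where "L = (\<lambda>l. [:[:root (2 * n) ((1 + cos (2 * real n * \<alpha> l)) / real M):]:]
      * ([:[:2:]:] * ([:[:cos (\<alpha> l):]:] * ?X + [:[:sin (\<alpha> l):]:] * ?Y)) ^ (2 * k + 1))"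
  define G where "G = (?X\<^sup>2 + ?Y\<^sup>2) ^ k"
  have G: "eval2 G (x, y) = (x\<^sup>2 + y\<^sup>2) ^ k" for x y
    unfolding G_def eval2_simps by simp
  have L: "eval2 (L l) (x, y) ^ (2 * n) = (1 + cos (2 * real n * \<alpha> l)) / real M
      * (2 * (cos (\<alpha> l) * x + sin (\<alpha> l) * y)) ^ (2 * N)" for l x y
  proof -
    have "(1 + cos (2 * real n * \<alpha> l)) / real M \<ge> 0"
      using cos_ge_minus_one[of "2 * real n * \<alpha> l"] by (intro divide_nonneg_nonneg) linarith+
    then have "root (2 * n) ((1 + cos (2 * real n * \<alpha> l)) / real M) ^ (2 * n)
        = (1 + cos (2 * real n * \<alpha> l)) / real M"
      using n by (intro real_root_pow_pos2) auto
    moreover have "(2 * k + 1) * (2 * n) = 2 * N" by (simp add: N_def)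
    ultimately show ?thesis
      unfolding L_def eval2_simps power_mult_distrib[of "root _ _"] power_mult[symmetric]
      by (simp only: fst_conv snd_conv)
  qed
  have "G ^ (2 * n) * f = (\<Sum>l<M. L l ^ (2 * n))"
  proof (rule eval2_eqI)
    fix x y
    have "N - n = k * (2 * n)" by (simp add: N_def)
    then have "(x\<^sup>2 + y\<^sup>2) ^ (N - n) = eval2 G (x, y) ^ (2 * n)"
      by (simp add: G power_mult)
    then have "real M * (\<Sum>l<M. eval2 (L l) (x, y) ^ (2 * n))
        = real M * (eval2 G (x, y) ^ (2 * n) * eval2 f (x, y))"
      using averaged_linear_form_powers[OF n M(1), of x y] M(2)
      unfolding L f sum_distrib_left C0_def C1_def \<alpha>_def by (simp add: mult.assoc)
    then show "eval2 (G ^ (2 * n) * f) (x, y) = eval2 (\<Sum>l<M. L l ^ (2 * n)) (x, y)"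
      using M(2) by simp
  qed
  then have GD: "G \<in> Denom (2 * n) f"
    unfolding Denom_def by blast
  have "eval2 G (1, 0) \<noteq> 0" by (simp add: G)
  then have "G \<noteq> 0" by auto
  with GD have "sum_of_powers_rat (2 * n) f"
    by (rule sum_of_powers_rat_if_Denom)
  moreover have "Bad (2 * n) f = {(0, 0)}"
  proof (intro equalityI subsetI)
    \<comment> \<open>The single denominator \<open>G\<close> already excludes every point except
      the origin.\<close>
    fix p assume "p \<in> Bad (2 * n) f"
    then have "eval2 G (fst p, snd p) = 0"
      using GD Denom_subset_denom_ideal[of "2 * n" f] by (auto simp: Bad_def real_zeros_def)
    then have "(fst p)\<^sup>2 + (snd p)\<^sup>2 = 0"
      unfolding G by simp
    then show "p \<in> {(0, 0)}"
      by (simp add: sum_power2_eq_zero_iff prod_eq_iff)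
  next
    have hom: "eval2 f (t * x, t * y) = t ^ (2 * n) * eval2 f (x, y)" for t x y
    proof -
      have "Complex (t * x) (t * y) = of_real t * Complex x y"
        by (simp add: complex_eq_iff)
      then have "Re (Complex (t * x) (t * y) ^ (2 * n)) = t ^ (2 * n) * Re (Complex x y ^ (2 * n))"
        by (simp add: power_mult_distrib flip: of_real_power)
      moreover have "((t * x)\<^sup>2 + (t * y)\<^sup>2) ^ n = t ^ (2 * n) * (x\<^sup>2 + y\<^sup>2) ^ n"
        by (simp add: power_mult_distrib power_mult flip: distrib_left)
      ultimately show ?thesis
        unfolding f by (simp add: algebra_simps)
    qed
    have cis_eq: "Complex (cos \<phi>) (sin \<phi>) ^ (2 * n) = cis (2 * real n * \<phi>)" for \<phi>
      using DeMoivre[of \<phi> "2 * n"] by (simp add: cis.code)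
    \<comment> \<open>The angle satisfies 2n \<open>?\<beta>\<close> = pi, so z^(2n) = -1
      here.\<close>
    have "eval2 f (cos ?\<beta>, sin ?\<beta>) = C0 - C1"
      unfolding f cis_eq using n by simp
    moreover have "eval2 f (cos ?\<beta>, - sin ?\<beta>) = C0 - C1"
      using f[of "cos (- ?\<beta>)" "sin (- ?\<beta>)"] n unfolding cis_eq by simp
    \<comment> \<open>The midpoint is \<open>cos ?\<beta>\<close> times (1, 0), so homogeneity
      produces the factor \<open>\<kappa>\<close>.\<close>
    moreover have "eval2 f (cos ?\<beta>, 0) = \<kappa> * (C0 + C1)"
    proof -
      have "eval2 f (1, 0) = C0 + C1"
        using f[of "cos 0" "sin 0"] unfolding cis_eq by simp
      then show ?thesis
        using hom[of "cos ?\<beta>" 1 0] by (simp add: \<kappa>_def)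
    qed
    ultimately have "eval2 f (cos ?\<beta>, sin ?\<beta>) + eval2 f (cos ?\<beta>, - sin ?\<beta>)
        < 2 * eval2 f (cos ?\<beta>, 0)"
      using gap by simp
    note vanish = denominator_vanishes_at_origin[OF n(1) hom this]
    fix p :: "real \<times> real" assume "p \<in> {(0, 0)}"
    then show "p \<in> Bad (2 * n) f"
      using denom_ideal_vanishes[OF vanish] by (auto simp: Bad_def real_zeros_def)
  qed
  ultimately show ?thesis
    using codim_point by metis
qed

end
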